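(* Let $k$ be an odd integer and let $l\ge 2$ be an even integer with $k\ge 2l+1$. Then $K\left(\frac{3k}{2}+\frac{l+1}{2},\,k\right)\ge 4k+2l$.
   Context: $I(d)$ is the graph of the $d$-dimensional hypercube (vertices are binary vectors of length $d$; edges join vectors differing in exactly one position). For a graph $G$, $d_G(x,y)$ is the graph distance in $G$. A circuit in $I(d)$ is a simple cycle $C=(x_1,\ldots,x_N)$ in $I(d)$; its length is $N$. A $(d,k)$ circuit code (circuit code of spread $k$ in dimension $d$) is a circuit $C$ in $I(d)$ such that for all vertices $x,y$ of $C$, $d_{I(d)}(x,y)<k$ implies $d_C(x,y)=d_{I(d)}(x,y)$. $K(d,k)$ denotes the maximum length of a $(d,k)$ circuit code. *)

theory Defs imports Main
begin

text \<open>Undirected graphs are represented by their edge sets, as symmetric relations.\<close>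

definition graph_dist :: "('a \<times> 'a) set \<Rightarrow> 'a \<Rightarrow> 'a \<Rightarrow> nat" where
  "graph_dist E x y = (LEAST n. (x, y) \<in> E ^^ n)"

definition hypercube_vertices :: "nat \<Rightarrow> bool list set" where
  "hypercube_vertices d = {x. length x = d}"

definition hypercube_edges :: "nat \<Rightarrow> (bool list \<times> bool list) set" where
  "hypercube_edges d =
     {(x, y). x \<in> hypercube_vertices d \<and> y \<in> hypercube_vertices d \<and>
              (\<exists>!i. i < d \<and> x ! i \<noteq> y ! i)}"

definition cycle_edges :: "'a list \<Rightarrow> ('a \<times> 'a) set" where
  "cycle_edges C =
     {(x, y). \<exists>i < length C.
        {x, y} = {C ! i, C ! (Suc i mod length C)}}"

text \<open>The bound \<open>3 \<le> length C\<close> excludes the degenerate closed walk along a single edge.\<close>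

definition circuit :: "nat \<Rightarrow> bool list list \<Rightarrow> bool" where
  "circuit d C \<longleftrightarrow> 3 \<le> length C \<and> distinct C \<and> set C \<subseteq> hypercube_vertices d \<and>
     cycle_edges C \<subseteq> hypercube_edges d"

definition circuit_code :: "nat \<Rightarrow> nat \<Rightarrow> bool list list \<Rightarrow> bool" where
  "circuit_code d k C \<longleftrightarrow> circuit d C \<and>
     (\<forall>x \<in> set C. \<forall>y \<in> set C.
        graph_dist (hypercube_edges d) x y < k \<longrightarrow>
        graph_dist (cycle_edges C) x y = graph_dist (hypercube_edges d) x y)"

text \<open>Circuits in dimension \<open>d\<close> have length at most \<open>2 ^ d\<close>, and for \<open>2 \<le> d\<close> a 4-cycle is a
  circuit code of every spread, so the maximum is then over a finite nonempty set.
  For \<open>d < 2\<close> there are no circuits and the value is unspecified.\<close>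

definition K :: "nat \<Rightarrow> nat \<Rightarrow> nat" where
  "K d k = Max {length C | C. circuit_code d k C}"

end

theory Submission imports Defs
begin

text \<open>A closed walk in the cube is given by its transition sequence. Take one of period
  \<open>n = 2 * k + l\<close> and run through it twice. In a period, \<open>(k + l - 1) div 2\<close> symbols
  occur twice, at positions \<open>2 * i\<close> and \<open>2 * i + g\<close>, where \<open>g = k + 1\<close> if \<open>l = 2\<close> and
  \<open>g = k + 2\<close> otherwise; every other symbol occurs once. So \<open>(3 * k + l + 1) div 2\<close> symbols are
  used. The vertices at the two ends of a window of length \<open>L \<le> n\<close> have Hamming distance \<open>L\<close>
  minus twice the number of symbols occurring twice in it, and there are at most
  \<open>(L - k) div 2\<close> of those.\<close>

section \<open>Walks in the hypercube\<close>

definition hamming :: "bool list \<Rightarrow> bool list \<Rightarrow> nat" where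
  "hamming x y = card {i. i < length x \<and> x ! i \<noteq> y ! i}"

lemma hamming_triangle_edge:
  assumes "length x = d" "(y, z) \<in> hypercube_edges d"
  shows "hamming x z \<le> Suc (hamming x y)"
proof -
  obtain i where i: "\<And>j. j < d \<Longrightarrow> y ! j \<noteq> z ! j \<Longrightarrow> j = i"
    using assms(2) unfolding hypercube_edges_def by blast
  have "{j. j < length x \<and> x ! j \<noteq> z ! j} \<subseteq> insert i {j. j < length x \<and> x ! j \<noteq> y ! j}"
    using i assms(1) by blast
  then have "hamming x z \<le> card (insert i {j. j < length x \<and> x ! j \<noteq> y ! j})"
    unfolding hamming_def by (intro card_mono) auto
  also have "\<dots> \<le> Suc (hamming x y)"
    unfolding hamming_def by (rule card_insert_le_m1) auto
  finally show ?thesis .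
qed

text \<open>Each step of a walk flips one coordinate. This bounds cube distance from below; the
  upper bound will come from walks along the circuit.\<close>

lemma hamming_le_walk_length:
  assumes "length x = d" "(x, y) \<in> hypercube_edges d ^^ m"
  shows "hamming x y \<le> m"
  using assms(2)
proof (induction m arbitrary: y)
  case 0
  then show ?case by (simp add: hamming_def)
next
  case (Suc m)
  then obtain z where "(x, z) \<in> hypercube_edges d ^^ m" "(z, y) \<in> hypercube_edges d"
    by auto
  then show ?case
    using Suc.IH[of z] hamming_triangle_edge[OF assms(1), of z y] by simp
qed

lemma graph_dist_le: "(x, y) \<in> E ^^ m \<Longrightarrow> graph_dist E x y \<le> m"
  unfolding graph_dist_def by (rule Least_le)

text \<open>\<open>LEAST\<close> is meaningful only if some walk exists; any walk, however long,
  ensures that the distance is attained.\<close>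

lemma graph_dist_walk: "(x, y) \<in> E ^^ m \<Longrightarrow> (x, y) \<in> E ^^ graph_dist E x y"
  unfolding graph_dist_def by (rule LeastI)

lemma relpow_sym: "sym E \<Longrightarrow> (x, y) \<in> E ^^ m \<Longrightarrow> (y, x) \<in> E ^^ m"
proof (induction m arbitrary: y)
  case (Suc m)
  then obtain z where "(x, z) \<in> E ^^ m" "(z, y) \<in> E" by auto
  with Suc have "(z, x) \<in> E ^^ m" "(y, z) \<in> E" by (auto dest: symD)
  then show ?case by (rule relpow_Suc_I2[rotated])
qed simp

lemma graph_dist_sym: "sym E \<Longrightarrow> graph_dist E x y = graph_dist E y x"
  unfolding graph_dist_def by (metis relpow_sym)

lemma sym_hypercube_edges: "sym (hypercube_edges d)"
proof (rule symI)
  fix x y assume "(x, y) \<in> hypercube_edges d"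
  moreover have "(\<lambda>i. i < d \<and> x ! i \<noteq> y ! i) = (\<lambda>i. i < d \<and> y ! i \<noteq> x ! i)" by auto
  ultimately show "(y, x) \<in> hypercube_edges d" unfolding hypercube_edges_def by simp
qed

lemma sym_cycle_edges: "sym (cycle_edges C)"
  unfolding cycle_edges_def by (rule symI) (auto simp: insert_commute)

lemma relpow_subset:
  fixes E F :: "('a \<times> 'a) set"
  shows "E \<subseteq> F \<Longrightarrow> E ^^ m \<subseteq> F ^^ m"
  by (induction m) (simp_all add: relcomp_mono)

lemma relpow_walk: "(\<And>t. (v t, v (Suc t)) \<in> E) \<Longrightarrow> (v s, v (s + L)) \<in> E ^^ L"
  by (induction L) auto

section \<open>Circuit codes from transition sequences\<close>

text \<open>Two flips of a coordinate cancel, so parity decides whether coordinate \<open>c\<close>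
  differs at the two ends of a window. The interval is half-open because step \<open>u\<close> leads
  from vertex \<open>u\<close> to vertex \<open>Suc u\<close>.\<close>

definition parity :: "(nat \<Rightarrow> nat) \<Rightarrow> nat \<Rightarrow> nat \<Rightarrow> nat \<Rightarrow> bool" where
  "parity \<sigma> s t c \<longleftrightarrow> odd (card {u \<in> {s..<t}. \<sigma> u = c})"

definition walk_dist :: "(nat \<Rightarrow> nat) \<Rightarrow> nat \<Rightarrow> nat \<Rightarrow> nat \<Rightarrow> nat" where
  "walk_dist \<sigma> d s L = card {c. c < d \<and> parity \<sigma> s (s + L) c}"

definition vertex :: "(nat \<Rightarrow> nat) \<Rightarrow> nat \<Rightarrow> nat \<Rightarrow> bool list" where
  "vertex \<sigma> d t = map (parity \<sigma> 0 t) [0..<d]"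

lemma parity_empty: "\<not> parity \<sigma> s s c"
  by (simp add: parity_def)

lemma parity_Suc:
  assumes "s \<le> t"
  shows "parity \<sigma> s (Suc t) c \<longleftrightarrow> parity \<sigma> s t c \<noteq> (\<sigma> t = c)"
proof -
  have "{u \<in> {s..<Suc t}. \<sigma> u = c} =
      (if \<sigma> t = c then insert t {u \<in> {s..<t}. \<sigma> u = c} else {u \<in> {s..<t}. \<sigma> u = c})"
    using assms by (auto simp: less_Suc_eq)
  then show ?thesis by (auto simp: parity_def)
qed

lemma parity_append:
  assumes "r \<le> s" "s \<le> t"
  shows "parity \<sigma> r t c \<longleftrightarrow> parity \<sigma> r s c \<noteq> parity \<sigma> s t c"
  using assms(2)
proof (induction rule: dec_induct)
  case base
  then show ?case by (simp add: parity_empty)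
next
  case (step t)
  then show ?case using assms(1) by (auto simp: parity_Suc)
qed

lemma parity_period:
  assumes "\<And>u. \<sigma> (u + n) = \<sigma> u"
  shows "parity \<sigma> (s + n) (t + n) c \<longleftrightarrow> parity \<sigma> s t c"
proof -
  have "{u \<in> {s + n..<t + n}. \<sigma> u = c} = (\<lambda>u. u + n) ` {u \<in> {s..<t}. \<sigma> u = c}"
  proof (intro equalityI subsetI)
    fix u assume u: "u \<in> {u \<in> {s + n..<t + n}. \<sigma> u = c}"
    then have "u = (u - n) + n" "\<sigma> (u - n) = c" "u - n \<in> {s..<t}"
      using assms[of "u - n"] by auto
    then show "u \<in> (\<lambda>u. u + n) ` {u \<in> {s..<t}. \<sigma> u = c}" by blast
  qed (use assms in auto)
  then show ?thesis by (simp add: parity_def card_image)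
qed

lemma length_vertex: "length (vertex \<sigma> d t) = d"
  by (simp add: vertex_def)

lemma hamming_vertex: "hamming (vertex \<sigma> d s) (vertex \<sigma> d (s + L)) = walk_dist \<sigma> d s L"
proof -
  have "{i. i < d \<and> parity \<sigma> 0 s i \<noteq> parity \<sigma> 0 (s + L) i} = {c. c < d \<and> parity \<sigma> s (s + L) c}"
    using parity_append[of 0 s "s + L" \<sigma>] by auto
  then show ?thesis
    unfolding hamming_def walk_dist_def length_vertex
    by (simp add: vertex_def cong: conj_cong)
qed

lemma vertex_edge:
  assumes "\<sigma> t < d"
  shows "(vertex \<sigma> d t, vertex \<sigma> d (Suc t)) \<in> hypercube_edges d"
  unfolding hypercube_edges_def hypercube_vertices_def
  using assms by (auto simp: vertex_def parity_Suc intro!: ex1I[of _ "\<sigma> t"])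

text \<open>The second period flips every coordinate as often as the first, so two periods together
  flip each an even number of times.\<close>

lemma vertex_period:
  assumes "\<And>u. \<sigma> (u + n) = \<sigma> u"
  shows "vertex \<sigma> d (t + 2 * n) = vertex \<sigma> d t"
proof -
  have "parity \<sigma> 0 (t + 2 * n) c = parity \<sigma> 0 t c" for c
  proof -
    have "parity \<sigma> 0 (t + 2 * n) c = (parity \<sigma> 0 (n + n) c \<noteq> parity \<sigma> (n + n) (t + n + n) c)"
      using parity_append[of 0 "n + n" "t + n + n" \<sigma> c] by (simp add: mult_2 add.assoc)
    also have "parity \<sigma> (n + n) (t + n + n) c = parity \<sigma> 0 t c"
      using parity_period[of \<sigma> n, OF assms, of n "t + n"] parity_period[of \<sigma> n, OF assms, of 0 t] by simp
    also have "parity \<sigma> 0 (n + n) c = (parity \<sigma> 0 n c \<noteq> parity \<sigma> n (n + n) c)"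
      by (rule parity_append) auto
    also have "parity \<sigma> n (n + n) c = parity \<sigma> 0 n c"
      using parity_period[of \<sigma> n, OF assms, of 0 n] by simp
    finally show ?thesis by simp
  qed
  then show ?thesis by (simp add: vertex_def)
qed

text \<open>Windows up to half the circuit suffice, since any two vertices bound one. If their cube
  distance is below \<open>k\<close>, then \<open>spread\<close> forces \<open>L\<close> \<le> cube
  distance \<le> circuit distance \<le> \<open>L\<close>.\<close>

theorem circuit_code_of_transitions:
  assumes symbols: "\<And>u. \<sigma> u < d"
    and period: "\<And>u. \<sigma> (u + n) = \<sigma> u"
    and n: "n \<ge> 2" and k: "k \<ge> 1"
    and spread: "\<And>s L. L \<le> n \<Longrightarrow> min k L \<le> walk_dist \<sigma> d s L"
  shows "circuit_code d k (map (vertex \<sigma> d) [0..<2 * n])"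
proof -
  define v where "v = vertex \<sigma> d"
  define C where "C = map v [0..<2 * n]"
  have len: "length C = 2 * n" by (simp add: C_def)
  have v_period: "v (t + 2 * n) = v t" for t
    unfolding v_def by (rule vertex_period[of \<sigma> n, OF period])
  have v_mod: "v (t mod (2 * n)) = v t" for t
  proof -
    have "v (r + q * (2 * n)) = v r" for r q
    proof (induction q)
      case (Suc q)
      then show ?case using v_period[of "r + q * (2 * n)"] by (simp add: ac_simps)
    qed simp
    from this[of "t mod (2 * n)" "t div (2 * n)"] show ?thesis by (simp only: mod_div_mult_eq)
  qed
  have C_nth: "C ! (t mod (2 * n)) = v t" for t
    using n v_mod by (simp add: C_def)
  have edge: "(v t, v (Suc t)) \<in> hypercube_edges d" for t
    unfolding v_def by (rule vertex_edge[of \<sigma>, OF symbols])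
  have cedge: "(v t, v (Suc t)) \<in> cycle_edges C" for t
    unfolding cycle_edges_def len
    using n C_nth[of t] C_nth[of "Suc t"]
    by (auto intro!: exI[of _ "t mod (2 * n)"] simp: mod_Suc_eq)
  have sub: "cycle_edges C \<subseteq> hypercube_edges d"
  proof
    fix e assume "e \<in> cycle_edges C"
    then obtain x y i where e: "e = (x, y)" and i: "i < 2 * n"
      and xy: "{x, y} = {C ! i, C ! (Suc i mod (2 * n))}"
      unfolding cycle_edges_def len by auto
    have "{x, y} = {v i, v (Suc i)}"
      using xy i C_nth[of "Suc i"] C_nth[of i] by simp
    with edge[of i] symD[OF sym_hypercube_edges edge[of i]] e
    show "e \<in> hypercube_edges d" by (auto simp: doubleton_eq_iff)
  qed
  \<comment> \<open>One of the two arcs between positions \<open>a\<close> and \<open>b\<close> has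
    length at most \<open>n\<close>; the arc through the end of the list runs from the larger
    position to the smaller one plus \<open>2 * n\<close>.\<close>
  have window: "\<exists>s L. L \<le> n \<and> (a \<noteq> b \<longrightarrow> 0 < L) \<and>
      ((v a = v s \<and> v b = v (s + L)) \<or> (v b = v s \<and> v a = v (s + L)))"
    if "a < 2 * n" "b < 2 * n" for a b
  proof -
    have *: "\<exists>s L. L \<le> n \<and> (a \<noteq> b \<longrightarrow> 0 < L) \<and>
      ((v a = v s \<and> v b = v (s + L)) \<or> (v b = v s \<and> v a = v (s + L)))"
      if "a \<le> b" "b < 2 * n" for a b
    proof (cases "b - a \<le> n")
      case True
      then show ?thesis using that by (intro exI[of _ a] exI[of _ "b - a"]) auto
    next
      case False
      then show ?thesis using that v_period[of a]
        by (intro exI[of _ b] exI[of _ "a + 2 * n - b"]) auto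
    qed
    show ?thesis
    proof (cases "a \<le> b")
      case True
      then show ?thesis using * that by blast
    next
      case False
      then have "b \<le> a" by simp
      then show ?thesis using *[of b a] that by blast
    qed
  qed
  have far: "min k L \<le> hamming (v s) (v (s + L))" if "L \<le> n" for s L
    unfolding v_def hamming_vertex using spread[OF that] .
  have inj: "inj_on v {0..<2 * n}"
  proof (rule inj_onI, rule ccontr)
    fix a b assume ab: "a \<in> {0..<2 * n}" "b \<in> {0..<2 * n}" "v a = v b" "a \<noteq> b"
    then obtain s L where "L \<le> n" "0 < L" "v s = v (s + L)"
      using window[of a b] by (metis atLeastLessThan_iff)
    with far[of L s] k show False by (simp add: hamming_def)
  qed
  have code: "graph_dist (cycle_edges C) x y = graph_dist (hypercube_edges d) x y"
    if walk: "x = v s" "y = v (s + L)" and L: "L \<le> n"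
      and close: "graph_dist (hypercube_edges d) x y < k" for x y s L
  proof -
    have walkC: "(x, y) \<in> cycle_edges C ^^ L"
      unfolding walk by (rule relpow_walk[of v, OF cedge])
    have walkH: "(x, y) \<in> hypercube_edges d ^^ L"
      unfolding walk by (rule relpow_walk[of v, OF edge])
    have "hamming x y \<le> graph_dist (hypercube_edges d) x y"
      by (rule hamming_le_walk_length[OF _ graph_dist_walk[OF walkH]])
        (simp add: walk v_def length_vertex)
    \<comment> \<open>The Hamming distance is below \<open>k\<close>, so the minimum in
      \<open>far\<close> must be \<open>L\<close>.\<close>
    then have "L \<le> graph_dist (hypercube_edges d) x y"
      using far[OF L, of s] close walk by auto
    moreover have "(x, y) \<in> hypercube_edges d ^^ graph_dist (cycle_edges C) x y"
      using relpow_subset[OF sub] graph_dist_walk[OF walkC] by blast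
    then have "graph_dist (hypercube_edges d) x y \<le> graph_dist (cycle_edges C) x y"
      by (rule graph_dist_le)
    moreover have "graph_dist (cycle_edges C) x y \<le> L"
      by (rule graph_dist_le[OF walkC])
    ultimately show ?thesis by simp
  qed
  have "circuit d C"
    unfolding circuit_def len
    using n sub inj
    by (auto simp: C_def distinct_map hypercube_vertices_def v_def length_vertex)
  moreover have "graph_dist (cycle_edges C) x y = graph_dist (hypercube_edges d) x y"
    if "x \<in> set C" "y \<in> set C" "graph_dist (hypercube_edges d) x y < k" for x y
  proof -
    obtain a b where ab: "a < 2 * n" "b < 2 * n" "x = v a" "y = v b"
      using \<open>x \<in> set C\<close> \<open>y \<in> set C\<close> unfolding C_def by auto
    from window[OF ab(1,2)] obtain s L where L: "L \<le> n"
      and "(x = v s \<and> y = v (s + L)) \<or> (y = v s \<and> x = v (s + L))"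
      using ab(3,4) by blast
    then consider "x = v s" "y = v (s + L)" | "y = v s" "x = v (s + L)" by blast
    then show ?thesis
    proof cases
      case 1
      then show ?thesis using code L that(3) by blast
    next
      case 2
      show ?thesis
        using code[OF 2 L] that(3) graph_dist_sym[OF sym_hypercube_edges, of d x y]
          graph_dist_sym[OF sym_cycle_edges, of C x y] by presburger
    qed
  qed
  ultimately show ?thesis
    unfolding circuit_code_def C_def v_def by blast
qed

section \<open>From a circuit code to a lower bound for \<open>K\<close>\<close>

lemma circuit_code_le_K:
  assumes "circuit_code d k C"
  shows "length C \<le> K d k"
proof -
  \<comment> \<open>A circuit visits each vertex at most once. Hence the set of lengths is finite,
    and its \<open>Max\<close> is a genuine upper bound.\<close>
  have "length C' \<le> card (hypercube_vertices d)" if "circuit_code d k C'" for C'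
  proof -
    have "distinct C'" "set C' \<subseteq> hypercube_vertices d"
      using that unfolding circuit_code_def circuit_def by auto
    moreover have "finite (hypercube_vertices d)"
      unfolding hypercube_vertices_def using finite_lists_length_eq[of "UNIV :: bool set" d] by simp
    ultimately show ?thesis by (metis card_mono distinct_card)
  qed
  then have "{length C' | C'. circuit_code d k C'} \<subseteq> {..card (hypercube_vertices d)}"
    by blast
  then have "finite {length C' | C'. circuit_code d k C'}"
    by (rule finite_subset) simp
  then show ?thesis unfolding K_def using assms by (intro Max_ge) blast+
qed

section \<open>Hamming distance and repeated symbols\<close>

text \<open>\<open>\<delta> u\<close> is the distance from \<open>u\<close> back to the previous occurrence of its symbol.\<close>

lemma walk_dist_eq:
  assumes symbols: "\<And>u. \<sigma> u < d"
    and prev: "\<And>u w. w < u \<Longrightarrow> u < w + n \<Longrightarrow> \<sigma> w = \<sigma> u \<longleftrightarrow> w + \<delta> u = u"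
    and pos: "\<And>u. 0 < \<delta> u"
    and "L \<le> n"
  shows "walk_dist \<sigma> d s L + 2 * card {j. j < L \<and> \<delta> (s + j) \<le> j} = L"
  using assms(4)
proof (induction L)
  case 0
  show ?case by (simp add: walk_dist_def parity_empty)
next
  case (Suc L)
  let ?A = "{c. c < d \<and> parity \<sigma> s (s + L) c}"
  let ?u = "s + L"
  have fin: "finite ?A" by simp
  \<comment> \<open>A symbol already seen in the window makes its coordinate agree again and lowers
    the distance by one; a new one raises it by one.\<close>
  have step: "{c. c < d \<and> parity \<sigma> s (s + Suc L) c} =
      (if parity \<sigma> s ?u (\<sigma> ?u) then ?A - {\<sigma> ?u} else insert (\<sigma> ?u) ?A)"
    using symbols by (auto simp: parity_Suc)
  \<comment> \<open>Positions in the window are less than \<open>n\<close> before \<open>?u\<close>,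
    so \<open>prev\<close> leaves at most one earlier occurrence.\<close>
  have "{w \<in> {s..<?u}. \<sigma> w = \<sigma> ?u} = (if \<delta> ?u \<le> L then {?u - \<delta> ?u} else {})"
    using prev[of _ ?u] pos[of ?u] Suc.prems by (auto split: if_splits)
  then have par: "parity \<sigma> s ?u (\<sigma> ?u) \<longleftrightarrow> \<delta> ?u \<le> L"
    unfolding parity_def by simp
  have cnt: "{j. j < Suc L \<and> \<delta> (s + j) \<le> j} =
      (if \<delta> ?u \<le> L then insert L {j. j < L \<and> \<delta> (s + j) \<le> j} else {j. j < L \<and> \<delta> (s + j) \<le> j})"
    by (auto simp: less_Suc_eq)
  have IH: "card ?A + 2 * card {j. j < L \<and> \<delta> (s + j) \<le> j} = L"
    using Suc unfolding walk_dist_def by simp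
  show ?case
  proof (cases "\<delta> ?u \<le> L")
    case True
    then have "\<sigma> ?u \<in> ?A" using par symbols by simp
    then have "Suc (card (?A - {\<sigma> ?u})) = card ?A"
      by (rule card_Suc_Diff1[OF fin])
    then show ?thesis
      unfolding walk_dist_def step cnt using True par IH by simp
  next
    case False
    then show ?thesis
      unfolding walk_dist_def step cnt using par IH by simp
  qed
qed

section \<open>The transition sequence\<close>

text \<open>Here \<open>k = 2 * a + 1\<close> and \<open>l = 2 * b\<close>.\<close>

locale transition_pattern =
  fixes a b :: nat
  assumes b_pos: "1 \<le> b"
begin

definition n :: nat where "n = 4 * a + 2 * b + 2"
text \<open>For \<open>b = 1\<close>, the value \<open>2 * a + 3\<close> would leave a cyclic gap
  \<open>n - g = k\<close>, and a window of length \<open>k + 1\<close> would have distance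
  \<open>k - 1\<close>. For larger \<open>b\<close>, the even value \<open>2 * a + 2\<close> would
  make some positions both first and second.\<close>

definition g :: nat where "g = (if b = 1 then 2 * a + 2 else 2 * a + 3)"
definition first :: "nat \<Rightarrow> bool" where "first r \<longleftrightarrow> even r \<and> r < 2 * (a + b)"
definition second :: "nat \<Rightarrow> bool" where "second r \<longleftrightarrow> g \<le> r \<and> first (r - g)"
text \<open>The earlier position of a pair serves as the name of its symbol.\<close>

definition rep :: "nat \<Rightarrow> nat" where "rep r = (if second r then r - g else r)"
text \<open>Cyclic distance: a first position is preceded by its partner in the previous period, and
  a symbol occurring once by itself.\<close>

definition gap :: "nat \<Rightarrow> nat" where
  "gap r = (if first r then n - g else if second r then g else n)"

lemma n_pos: "0 < n"
  by (simp add: n_def)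

lemma g_pos: "0 < g" and g_less_n: "g < n"
  using b_pos by (auto simp: n_def g_def)

lemma gap_pos: "0 < gap r"
  using g_pos g_less_n by (simp add: gap_def)

lemma first_less:
  assumes "first r"
  shows "r + g < n"
proof -
  obtain i where "r = 2 * i" "i < a + b" using assms by (auto simp: first_def elim!: evenE)
  then show ?thesis using b_pos by (auto simp: n_def g_def)
qed

text \<open>For \<open>b = 1\<close>, \<open>g = 2 * (a + b)\<close> lies beyond all first
  positions. Otherwise \<open>g\<close> is odd and every second position is odd.\<close>

lemma first_not_second:
  assumes "first r"
  shows "\<not> second r"
proof (cases "b = 1")
  case True
  then show ?thesis using assms unfolding first_def second_def g_def by auto
next
  case False
  show ?thesis
  proof
    assume "second r"
    with False have "odd r" by (auto simp: second_def first_def g_def)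
    then show False using assms by (simp add: first_def)
  qed
qed

section \<open>Previous occurrences and the number of symbols\<close>

lemma rep_eq_iff_less:
  assumes "q < r" "r < n"
  shows "rep q = rep r \<longleftrightarrow> q + gap r = r"
proof -
  consider "first r" | "second r" "\<not> first r" | "\<not> first r" "\<not> second r" by blast
  then show ?thesis
  proof cases
    case 1
    then show ?thesis
      using assms first_less[OF 1] first_not_second[OF 1] by (auto simp: rep_def gap_def)
  next
    case 2
    show ?thesis
    proof (cases "second q")
      case True
      \<comment> \<open>Otherwise \<open>q = r - g\<close> would be both first and second.\<close>
      have "q + g \<noteq> r" using 2(1) True first_not_second[of q] by (auto simp: second_def)
      then show ?thesis using True 2 assms(1) by (auto simp: rep_def gap_def second_def)
    next
      case False
      then show ?thesis using 2 assms(1) by (auto simp: rep_def gap_def second_def)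
    qed
  next
    case 3
    then show ?thesis using assms by (auto simp: rep_def gap_def)
  qed
qed

text \<open>Here \<open>q\<close> is read as a position in the period before that of
  \<open>r\<close>.\<close>

lemma rep_eq_iff_wrap:
  assumes "r < q" "q < n"
  shows "rep q = rep r \<longleftrightarrow> q + gap r = r + n"
proof -
  consider "first r" | "second r" "\<not> first r" | "\<not> first r" "\<not> second r" by blast
  then show ?thesis
  proof cases
    case 1
    have "q + (n - g) = r + n \<longleftrightarrow> q = r + g" using g_less_n by linarith
    then show ?thesis
      using 1 assms(1) first_not_second[OF 1] g_pos by (auto simp: rep_def gap_def second_def)
  next
    case 2
    then show ?thesis using assms by (auto simp: rep_def gap_def second_def)
  next
    case 3
    then show ?thesis using assms by (auto simp: rep_def gap_def second_def)
  qed
qed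

lemma rep_mod_eq_iff:
  assumes "w < u" "u < w + n"
  shows "rep (w mod n) = rep (u mod n) \<longleftrightarrow> w + gap (u mod n) = u"
proof -
  have u: "u div n * n + u mod n = u" and w: "w div n * n + w mod n = w"
    by (simp_all only: div_mult_mod_eq)
  have lt: "u mod n < n" "w mod n < n" using n_pos by simp_all
  have "w div n \<le> u div n" using assms by (simp add: div_le_mono)
  moreover have "u div n \<le> Suc (w div n)"
    using div_le_mono[of u "w + n" n] assms div_add_self2[of n w] n_pos by linarith
  ultimately consider "u div n = w div n" | "u div n = Suc (w div n)" by linarith
  then show ?thesis
  proof cases
    case 1
    then have "w + (u mod n) = u + (w mod n)" using u w by simp
    then show ?thesis using rep_eq_iff_less[of "w mod n" "u mod n"] lt assms by linarith
  next
    case 2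
    then have "w + n + u mod n = u + w mod n" using u w by simp
    then show ?thesis using rep_eq_iff_wrap[of "u mod n" "w mod n"] lt assms by linarith
  qed
qed

text \<open>No second position is a value of \<open>rep\<close>, which removes \<open>a + b\<close>
  of the \<open>n\<close> candidates and leaves exactly the dimension.\<close>

lemma card_rep_image: "card (rep ` {..<n}) \<le> 3 * a + b + 2"
proof -
  let ?S = "(\<lambda>i. 2 * i + g) ` {..<a + b}"
  have first_double: "first (2 * i)" if "i < a + b" for i
    using that by (simp add: first_def)
  have S: "?S \<subseteq> {..<n}"
    using first_less[OF first_double] by auto
  have "rep r \<notin> ?S" for r
  proof
    assume "rep r \<in> ?S"
    then have "second (rep r)" using first_double by (auto simp: second_def)
    then show False
      using first_not_second[of "r - g"] by (auto simp: rep_def second_def split: if_splits)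
  qed
  moreover have "rep r < n" if "r < n" for r using that by (simp add: rep_def less_imp_diff_less)
  ultimately have "rep ` {..<n} \<subseteq> {..<n} - ?S" by auto
  then have "card (rep ` {..<n}) \<le> card ({..<n} - ?S)"
    by (intro card_mono) auto
  also have "\<dots> = n - (a + b)"
    using S by (subst card_Diff_subset) (auto simp: card_image inj_on_def)
  finally show ?thesis by (simp add: n_def)
qed

section \<open>Counting repeats in a window\<close>

definition firsts_below :: "nat \<Rightarrow> nat" where
  "firsts_below x = min (a + b) (Suc x div 2)"

lemma firsts_below_0: "firsts_below 0 = 0"
  by (simp add: firsts_below_def)

text \<open>With the value 0 at 0, this identifies \<open>firsts_below x\<close> as the number of
  first positions below \<open>x\<close>; \<open>Suc x div 2\<close> is half of \<open>x\<close>
  rounded up.\<close>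

lemma firsts_below_Suc: "firsts_below (Suc x) = firsts_below x + of_bool (first x)"
  unfolding firsts_below_def first_def
  by (cases "even x"; elim evenE oddE; auto simp: min_def)

lemma firsts_below_mono: "x \<le> y \<Longrightarrow> firsts_below x \<le> firsts_below y"
  unfolding firsts_below_def by (intro min.mono div_le_mono) auto

text \<open>The guard \<open>e \<le> s + j\<close> stops truncated subtraction from sending earlier
  positions to 0, which is a first position. On the right, truncation is harmless because
  \<open>firsts_below 0 = 0\<close>.\<close>

lemma card_firsts:
  "card {j. j < L \<and> c \<le> j \<and> e \<le> s + j \<and> first (s + j - e)} =
    firsts_below (s + L - e) - firsts_below (s + c - e)"
proof (cases "c \<le> L")
  case False
  then have "{j. j < L \<and> c \<le> j \<and> e \<le> s + j \<and> first (s + j - e)} = {}" by auto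
  moreover have "firsts_below (s + L - e) \<le> firsts_below (s + c - e)"
    using False by (intro firsts_below_mono) simp
  ultimately show ?thesis by (simp only: card.empty diff_is_0_eq)
next
  case True
  then show ?thesis
  proof (induction rule: dec_induct)
    case base
    have "{j. j < c \<and> c \<le> j \<and> e \<le> s + j \<and> first (s + j - e)} = {}" by auto
    then show ?case by simp
  next
    case (step L)
    let ?A = "{j. j < L \<and> c \<le> j \<and> e \<le> s + j \<and> first (s + j - e)}"
    have A: "{j. j < Suc L \<and> c \<le> j \<and> e \<le> s + j \<and> first (s + j - e)} =
        (if e \<le> s + L \<and> first (s + L - e) then insert L ?A else ?A)"
      using step.hyps by (auto simp: less_Suc_eq)
    have mono: "firsts_below (s + c - e) \<le> firsts_below (s + L - e)"
      using step.hyps by (intro firsts_below_mono) auto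
    show ?case
    proof (cases "e \<le> s + L")
      case True
      then have "s + Suc L - e = Suc (s + L - e)" by simp
      then show ?thesis
        unfolding A using True mono step.IH firsts_below_Suc[of "s + L - e"]
        by (simp add: Suc_diff_le)
    next
      case False
      then show ?thesis unfolding A using step.IH by simp
    qed
  qed
qed

lemma card_gap_le:
  assumes s: "s < n" and L: "L \<le> n"
  shows "card {j. j < L \<and> gap ((s + j) mod n) \<le> j} \<le>
    firsts_below (s + L - n) - firsts_below (s - g) +
    (firsts_below (s + L - g) - firsts_below s) + firsts_below (s + L - (n + g))"
proof -
  let ?S = "\<lambda>c e. {j. j < L \<and> c \<le> j \<and> e \<le> s + j \<and> first (s + j - e)}"
  \<comment> \<open>Starting in period zero, a window meets at most two periods. The three sets hold
    the first positions of the next period, the second positions of this one and those of the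
    next.\<close>
  have sub: "{j. j < L \<and> gap ((s + j) mod n) \<le> j} \<subseteq> ?S (n - g) n \<union> (?S g g \<union> ?S g (n + g))"
  proof
    fix j assume "j \<in> {j. j < L \<and> gap ((s + j) mod n) \<le> j}"
    then have j: "j < L" "gap ((s + j) mod n) \<le> j" by simp_all
    show "j \<in> ?S (n - g) n \<union> (?S g g \<union> ?S g (n + g))"
    proof (cases "s + j < n")
      case True
      \<comment> \<open>A first position of this period is no repeat: its partner lies before
        position 0.\<close>
      then have "gap (s + j) \<le> j" using j(2) by simp
      then show ?thesis
        using True j(1) L first_less[of "s + j"]
        by (auto simp: gap_def second_def split: if_splits)
    next
      case False
      then have "(s + j) mod n = s + j - n"
        using s j(1) L by (simp add: mod_if)
      then have "gap (s + j - n) \<le> j" using j(2) by simp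
      then show ?thesis
        using False j(1) L by (auto simp: gap_def second_def split: if_splits)
    qed
  qed
  have start: "s + (n - g) - n = s - g" "s + g - g = s" "s + g - (n + g) = 0"
    using g_less_n s by simp_all
  have "card {j. j < L \<and> gap ((s + j) mod n) \<le> j} \<le>
      card (?S (n - g) n \<union> (?S g g \<union> ?S g (n + g)))"
    by (rule card_mono[OF _ sub]) simp
  also have "\<dots> \<le> card (?S (n - g) n) + (card (?S g g) + card (?S g (n + g)))"
    by (intro order.trans[OF card_Un_le] add_left_mono card_Un_le)
  finally show ?thesis
    unfolding card_firsts start firsts_below_0 diff_zero add.assoc .
qed

lemma firsts_below_le: "firsts_below x \<le> a + b"
  by (simp add: firsts_below_def)

lemma firsts_below_upper: "2 * firsts_below x \<le> x + 1"
  unfolding firsts_below_def by (simp add: min_def; linarith)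

lemma firsts_below_eq: "2 * (a + b) \<le> x + 1 \<Longrightarrow> firsts_below x = a + b"
  unfolding firsts_below_def min_def by simp linarith

lemma firsts_below_lower: "x \<le> 2 * (a + b) \<Longrightarrow> x \<le> 2 * firsts_below x"
  unfolding firsts_below_def min_def by simp linarith

text \<open>Below length \<open>g\<close> nothing repeats, since both gaps are at least
  \<open>g\<close>. Beyond it, rounding errors in \<open>firsts_below\<close> are absorbed by
  \<open>g \<ge> k + 1\<close> and \<open>n = 2 * M + k + 1\<close>, where
  \<open>k = 2 * a + 1\<close> and \<open>M\<close> is the number of pairs.\<close>

lemma below_bound:
  assumes s: "s < n" and L: "L \<le> n"
  shows "firsts_below (s + L - n) - firsts_below (s - g) +
    (firsts_below (s + L - g) - firsts_below s) + firsts_below (s + L - (n + g))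
    \<le> (L - (2 * a + 1)) div 2"
proof -
  let ?P = firsts_below
  define M where "M = a + b"
  note le_M = firsts_below_le[folded M_def]
  define B where "B = ?P (s + L - n) - ?P (s - g)"
  define C where "C = ?P (s + L - g) - ?P s + ?P (s + L - (n + g))"
  have g: "b = 1 \<and> g = 2 * M \<and> n = 4 * M \<and> g = 2 * a + 2 \<or>
      2 \<le> b \<and> n + 1 = 2 * M + g \<and> g = 2 * a + 3"
    using b_pos by (auto simp: n_def g_def M_def)
  have gn: "2 * g \<le> n" "n \<le> 2 * M + g" "2 * a + 2 \<le> g"
    "2 * M + 2 * a + 2 = n" "g \<le> 2 * a + 3"
    using b_pos by (auto simp: n_def g_def M_def)
  have B: "B \<le> ?P (s + L - n) - ?P (s - g)" by (simp add: B_def)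
  have bound: "2 * B + 2 * C + (2 * a + 1) \<le> L" if "g \<le> L"
  proof -
    have C: "C = ?P (s + L - g) - ?P s + ?P (s + L - (n + g))" by (simp add: C_def)
    have z: "s - g \<le> 2 * ?P (s - g)"
      using s gn by (intro firsts_below_lower) (simp add: M_def)
    \<comment> \<open>The window may end in this period, before the second positions of the next, or
      among or after them. A full period stands apart because the last case needs
      \<open>L < n\<close>.\<close>
    have "L = n \<or> s + L \<le> n \<or> n < s + L \<and> s + L \<le> n + g \<or> n + g < s + L \<and> L < n"
      using L by linarith
    then consider "L = n" | "s + L \<le> n" | "n < s + L" "s + L \<le> n + g"
      | "n + g < s + L" "L < n"
      by blast
    then show ?thesis
    proof cases
      case 1
      \<comment> \<open>The differences telescope: each pair contributes at most one repeat.\<close>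
      have "?P (s - g) \<le> ?P s" "?P s \<le> ?P (s + n - g)"
        using g_less_n by (intro firsts_below_mono; simp)+
      moreover have "B \<le> ?P s - ?P (s - g)" "C = ?P (s + n - g) - ?P s + ?P (s - g)"
        using 1 B C by simp_all
      ultimately have "B + C \<le> ?P (s + n - g)" by linarith
      then have "B + C \<le> M" using le_M le_trans by blast
      then show ?thesis
        using 1 gn by linarith
    next
      case 2
      then have "B = 0" "C = ?P (s + L - g) - ?P s" using B C by (simp_all add: firsts_below_0)
      then have BC: "B + C = ?P (s + L - g) - ?P s" by simp
      show ?thesis
      proof (cases "s \<le> 2 * M")
        case True
        then have "s \<le> 2 * ?P s" by (intro firsts_below_lower) (simp add: M_def)
        moreover have "2 * ?P (s + L - g) \<le> s + (L - g) + 1"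
          using firsts_below_upper[of "s + L - g"] \<open>g \<le> L\<close> by simp
        ultimately show ?thesis using BC gn \<open>g \<le> L\<close> by linarith
      next
        case False
        then have "?P s = M" using firsts_below_eq[of s] by (simp add: M_def)
        then show ?thesis
          using BC gn \<open>g \<le> L\<close> le_M[of "s + L - g"] by (simp add: M_def)
      qed
    next
      case 3
      then have C': "C = ?P (s + L - g) - ?P s" using C by (simp add: firsts_below_0)
      have y: "2 * ?P (s + L - n) + n \<le> s + L + 1"
        using firsts_below_upper[of "s + L - n"] 3 by linarith
      show ?thesis
      proof (cases "2 * M \<le> s + 1")
        \<comment> \<open>All first positions of this period precede the window, so none of its
          second positions count.\<close>
        case True
        then have "?P s = M" using firsts_below_eq[of s] by (simp add: M_def)
        then have "C = 0" using C' le_M[of "s + L - g"] by (simp add: M_def)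
        then show ?thesis using B y z True g gn s 3 that by linarith
      next
        case False
        then have "s \<le> 2 * ?P s" by (intro firsts_below_lower) (simp add: M_def)
        then have "2 * C + s \<le> 2 * M"
          using C' le_M[of "s + L - g"] False by linarith
        moreover have "2 * B + n \<le> s + L + 1" using B y 3 by linarith
        ultimately show ?thesis using g gn that by linarith
      qed
    next
      case 4
      have z': "s \<le> 2 * ?P (s - g) + g" using z by linarith
      have w: "2 * ?P (s + L - (n + g)) + n + g \<le> s + L + 1"
        using firsts_below_upper[of "s + L - (n + g)"] 4 by linarith
      show ?thesis
      proof (cases "2 * M \<le> s + 1")
        case True
        then have "?P s = M" using firsts_below_eq[of s] by (simp add: M_def)
        then have "C = ?P (s + L - (n + g))"
          using C le_M[of "s + L - g"] by (simp add: M_def)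
        moreover have "2 * B + s \<le> 2 * M + g"
          using B z' le_M[of "s + L - n"] s gn by linarith
        ultimately show ?thesis using w g gn that by linarith
      next
        case False
        have "s \<le> 2 * ?P s" using False by (intro firsts_below_lower) (simp add: M_def)
        then have "2 * (?P (s + L - g) - ?P s) + s \<le> 2 * M"
          using le_M[of "s + L - g"] False by linarith
        moreover have "2 * ?P (s + L - n) + n \<le> s + L + 1"
          using firsts_below_upper[of "s + L - n"] 4 by linarith
        then have "B = 0 \<or> 2 * B + n \<le> L + g + 1" using B z' by arith
        \<comment> \<open>When \<open>B\<close> is positive, two estimates round up by one each;
          \<open>L < n\<close> makes up for the extra unit.\<close>
        ultimately show ?thesis using w C 4 g gn False that by linarith
      qed
    qed
  qed
  have "B + C \<le> (L - (2 * a + 1)) div 2"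
  proof (cases "g \<le> L")
    case True
    then show ?thesis using bound by linarith
  next
    case False
    then have "?P (s + L - n) \<le> ?P (s - g)" "?P (s + L - g) \<le> ?P s" "s + L - (n + g) = 0"
      using s L gn by (simp_all add: firsts_below_mono)
    then show ?thesis by (simp add: B_def C_def firsts_below_0)
  qed
  then show ?thesis unfolding B_def C_def add.assoc .
qed

section \<open>Assembling the code and the bound\<close>

theorem ex_circuit_code: "\<exists>C. circuit_code (3 * a + b + 2) (2 * a + 1) C \<and> length C = 2 * n"
proof -
  \<comment> \<open>\<open>f\<close> numbers the symbols from 0, turning them into
    coordinates.\<close>
  obtain f where f: "bij_betw f (rep ` {..<n}) {0..<card (rep ` {..<n})}"
    using ex_bij_betw_finite_nat[of "rep ` {..<n}"] by auto
  define \<sigma> where "\<sigma> u = f (rep (u mod n))" for u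
  have mem: "rep (u mod n) \<in> rep ` {..<n}" for u
    using n_pos by simp
  have symbols: "\<sigma> u < 3 * a + b + 2" for u
  proof -
    have "\<sigma> u \<in> {0..<card (rep ` {..<n})}"
      unfolding \<sigma>_def using f mem by (rule bij_betwE[rule_format])
    then show ?thesis using card_rep_image by simp
  qed
  have period: "\<sigma> (u + n) = \<sigma> u" for u
    by (simp add: \<sigma>_def)
  have "\<sigma> w = \<sigma> u \<longleftrightarrow> rep (w mod n) = rep (u mod n)" for u w
    unfolding \<sigma>_def using bij_betw_imp_inj_on[OF f] mem by (simp add: inj_on_eq_iff)
  then have prev: "\<sigma> w = \<sigma> u \<longleftrightarrow> w + gap (u mod n) = u" if "w < u" "u < w + n" for u w
    using rep_mod_eq_iff[OF that] by simp
  have spread: "min (2 * a + 1) L \<le> walk_dist \<sigma> (3 * a + b + 2) s L" if L: "L \<le> n" for s L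
  proof -
    have "card {j. j < L \<and> gap ((s + j) mod n) \<le> j} =
        card {j. j < L \<and> gap ((s mod n + j) mod n) \<le> j}"
      by (simp add: mod_add_left_eq)
    also have "\<dots> \<le> (L - (2 * a + 1)) div 2"
      using L n_pos by (intro order.trans[OF card_gap_le below_bound]) simp_all
    finally have "2 * card {j. j < L \<and> gap ((s + j) mod n) \<le> j} \<le> L - (2 * a + 1)"
      by linarith
    moreover have "walk_dist \<sigma> (3 * a + b + 2) s L + 2 * card {j. j < L \<and> gap ((s + j) mod n) \<le> j} = L"
      using symbols prev gap_pos L by (rule walk_dist_eq)
    \<comment> \<open>With truncated subtraction, \<open>L - (L - k)\<close> is
      \<open>min k L\<close>.\<close>
    ultimately show ?thesis by linarith
  qed
  have "circuit_code (3 * a + b + 2) (2 * a + 1) (map (vertex \<sigma> (3 * a + b + 2)) [0..<2 * n])"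
    using symbols period _ _ spread by (rule circuit_code_of_transitions) (simp_all add: n_def)
  moreover have "length (map (vertex \<sigma> (3 * a + b + 2)) [0..<2 * n]) = 2 * n" by simp
  ultimately show ?thesis by blast
qed

end

theorem corollary3p10:
  fixes k l :: nat
  assumes "odd k" and "even l" and "l \<ge> 2" and "k \<ge> 2 * l + 1"
  shows "K ((3 * k + l + 1) div 2) k \<ge> 4 * k + 2 * l"
proof -
  obtain a b where k: "k = 2 * a + 1" and l: "l = 2 * b"
    using assms(1,2) by (auto elim!: oddE evenE)
  interpret transition_pattern a b
    using assms(3) l by unfold_locales simp
  obtain C where C: "circuit_code (3 * a + b + 2) (2 * a + 1) C" "length C = 2 * n"
    using ex_circuit_code by blast
  have "(3 * k + l + 1) div 2 = 3 * a + b + 2" "2 * n = 4 * k + 2 * l"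
    by (simp_all add: k l n_def)
  then show ?thesis using circuit_code_le_K[OF C(1)] C(2) k by simp
qed

end
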